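(* Let $N\ge 3$ be an integer. For a prime power $q$, let $t_2(N,q)$ be the smallest size of a complete cap in $\mathrm{PG}(N,q)$. Let $D\ge 1$ be a real constant (independent of $q$), and let $q_0$ be a positive integer. The hypothesis $\mathrm{Conj}(N,D,q_0)$ is defined in the context. (i) If $\mathrm{Conj}(N,D,q_0)$ holds, then for every prime power $q\ge q_0$ $$t_2(N,q)<\frac{\sqrt{q^{N+1}}}{q-1}\left(\sqrt{D}\sqrt{(N+1)\ln q}+1\right)+2,$$ where for fixed $N$ and $D$ the right-hand side is asymptotically equivalent, as $q\to\infty$, to $\sqrt{D}\,q^{\frac{N-1}{2}}\sqrt{(N+1)\ln q}$ (the ratio tends to $1$). (ii) If $\mathrm{Conj}(N,1,q_0)$ holds, then for every prime power $q\ge q_0$ $$t_2(N,q)<\frac{\sqrt{q^{N+1}}}{q-1}\left(\sqrt{(N+1)\ln q}+1\right)+2,$$ where for fixed $N$ the right-hand side is asymptotically equivalent, as $q\to\infty$, to $q^{\frac{N-1}{2}}\sqrt{(N+1)\ln q}$.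
   Context: $\mathrm{PG}(N,q)$ is the $N$-dimensional projective space over the field $\mathbb{F}_q$; it has $\theta_{N,q}=\frac{q^{N+1}-1}{q-1}$ points. A $k$-cap is a set of $k$ points no three of which are collinear; it is complete if it is not contained in a $(k+1)$-cap. A point is covered by a cap $\mathcal{K}$ if it belongs to $\mathcal{K}$ or lies on a line meeting $\mathcal{K}$ in two points. $\mathcal{U}(\mathcal{K})$ denotes the set of points of $\mathrm{PG}(N,q)$ not covered by $\mathcal{K}$. For integers $w\ge1$, $U_w\ge 0$, $\mathbf{S}(U_w)$ denotes the set of all $w$-caps $\mathcal{K}_w$ in $\mathrm{PG}(N,q)$ with $\#\mathcal{U}(\mathcal{K}_w)=U_w$. For a $w$-cap $\mathcal{K}_w$ and $A_{w+1}\in\mathcal{U}(\mathcal{K}_w)$ put $$\Delta_w(A_{w+1})=\#\mathcal{U}(\mathcal{K}_w)-\#\mathcal{U}(\mathcal{K}_w\cup\{A_{w+1}\}).$$ Hypothesis $\mathrm{Conj}(N,D,q_0)$: for every prime power $q\ge q_0$, and for all integers $w\ge 1$, $U_w\ge 1$ such that $\mathbf{S}(U_w)$ is nonempty, there exist a $w$-cap $\mathcal{K}_w\in\mathbf{S}(U_w)$ and a point $A_{w+1}\in\mathcal{U}(\mathcal{K}_w)$ such that $$\Delta_w(A_{w+1})\ge \frac1D\cdot\frac{(w(q-1)+1)\,U_w}{\theta_{N,q}}.$$ *)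

theory Defs
  imports
    "HOL-Algebra.Ring"
    "HOL-Library.FuncSet"
    "HOL-Library.Landau_Symbols"
    "HOL-Number_Theory.Prime_Powers"
begin

text \<open>
  Homogeneous coordinate vectors of \<open>PG(N,F)\<close> have \<open>N + 1\<close> coordinates, indexed by \<open>0, \<dots>, N\<close>.
\<close>

definition nonzero_vecs :: "('a, 'm) ring_scheme \<Rightarrow> nat \<Rightarrow> (nat \<Rightarrow> 'a) set" where
  "nonzero_vecs F N = {v \<in> {..N} \<rightarrow>\<^sub>E carrier F. \<exists>i\<le>N. v i \<noteq> \<zero>\<^bsub>F\<^esub>}"

definition span1 :: "('a, 'm) ring_scheme \<Rightarrow> nat \<Rightarrow> (nat \<Rightarrow> 'a) \<Rightarrow> (nat \<Rightarrow> 'a) set" where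
  "span1 F N u = {\<lambda>i\<in>{..N}. a \<otimes>\<^bsub>F\<^esub> u i | a. a \<in> carrier F}"

definition span2 ::
  "('a, 'm) ring_scheme \<Rightarrow> nat \<Rightarrow> (nat \<Rightarrow> 'a) \<Rightarrow> (nat \<Rightarrow> 'a) \<Rightarrow> (nat \<Rightarrow> 'a) set" where
  "span2 F N u v =
     {\<lambda>i\<in>{..N}. a \<otimes>\<^bsub>F\<^esub> u i \<oplus>\<^bsub>F\<^esub> b \<otimes>\<^bsub>F\<^esub> v i | a b. a \<in> carrier F \<and> b \<in> carrier F}"

text \<open>
  Points are the one-dimensional subspaces of the coordinate space; a line is the set of all
  points contained in a two-dimensional subspace.
\<close>

definition pg_points :: "('a, 'm) ring_scheme \<Rightarrow> nat \<Rightarrow> (nat \<Rightarrow> 'a) set set" where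
  "pg_points F N = span1 F N ` nonzero_vecs F N"

definition pg_lines :: "('a, 'm) ring_scheme \<Rightarrow> nat \<Rightarrow> (nat \<Rightarrow> 'a) set set set" where
  "pg_lines F N =
     {{P \<in> pg_points F N. P \<subseteq> span2 F N u v} | u v.
        u \<in> nonzero_vecs F N \<and> v \<in> nonzero_vecs F N \<and> span1 F N u \<noteq> span1 F N v}"

definition pg_collinear :: "('a, 'm) ring_scheme \<Rightarrow> nat \<Rightarrow> (nat \<Rightarrow> 'a) set set \<Rightarrow> bool" where
  "pg_collinear F N S \<longleftrightarrow> (\<exists>l\<in>pg_lines F N. S \<subseteq> l)"

definition pg_theta :: "nat \<Rightarrow> nat \<Rightarrow> real" where
  "pg_theta N q = (real q ^ (N + 1) - 1) / (real q - 1)"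

definition cap :: "('a, 'm) ring_scheme \<Rightarrow> nat \<Rightarrow> nat \<Rightarrow> (nat \<Rightarrow> 'a) set set \<Rightarrow> bool" where
  "cap F N k K \<longleftrightarrow>
     K \<subseteq> pg_points F N \<and> finite K \<and> card K = k \<and>
     (\<forall>P\<in>K. \<forall>Q\<in>K. \<forall>R\<in>K.
        P \<noteq> Q \<and> P \<noteq> R \<and> Q \<noteq> R \<longrightarrow> \<not> pg_collinear F N {P, Q, R})"

definition complete_cap :: "('a, 'm) ring_scheme \<Rightarrow> nat \<Rightarrow> nat \<Rightarrow> (nat \<Rightarrow> 'a) set set \<Rightarrow> bool" where
  "complete_cap F N k K \<longleftrightarrow> cap F N k K \<and> \<not> (\<exists>K'. cap F N (k + 1) K' \<and> K \<subseteq> K')"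

definition t2 :: "('a, 'm) ring_scheme \<Rightarrow> nat \<Rightarrow> nat" where
  "t2 F N = (LEAST k. \<exists>K. complete_cap F N k K)"

definition covered ::
  "('a, 'm) ring_scheme \<Rightarrow> nat \<Rightarrow> (nat \<Rightarrow> 'a) set set \<Rightarrow> (nat \<Rightarrow> 'a) set \<Rightarrow> bool" where
  "covered F N K P \<longleftrightarrow> P \<in> K \<or> (\<exists>l\<in>pg_lines F N. P \<in> l \<and> card (l \<inter> K) = 2)"

definition uncovered ::
  "('a, 'm) ring_scheme \<Rightarrow> nat \<Rightarrow> (nat \<Rightarrow> 'a) set set \<Rightarrow> (nat \<Rightarrow> 'a) set set" where
  "uncovered F N K = {P \<in> pg_points F N. \<not> covered F N K P}"

definition caps_uncovering ::
  "('a, 'm) ring_scheme \<Rightarrow> nat \<Rightarrow> nat \<Rightarrow> nat \<Rightarrow> (nat \<Rightarrow> 'a) set set set" where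
  "caps_uncovering F N w U = {K. cap F N w K \<and> card (uncovered F N K) = U}"

definition newly_covered ::
  "('a, 'm) ring_scheme \<Rightarrow> nat \<Rightarrow> (nat \<Rightarrow> 'a) set set \<Rightarrow> (nat \<Rightarrow> 'a) set \<Rightarrow> int" where
  "newly_covered F N K A =
     int (card (uncovered F N K)) - int (card (uncovered F N (K \<union> {A})))"

text \<open>
  The field with \<open>q\<close> elements, unique up to isomorphism, is represented by an arbitrary field
  with \<open>q\<close> elements whose carrier is a set of natural numbers. Every finite field is isomorphic
  to one of these, and all notions above are invariant under isomorphism of the field.
\<close>

definition Fq :: "nat \<Rightarrow> nat ring \<Rightarrow> bool" where
  "Fq q F \<longleftrightarrow> field F \<and> card (carrier F) = q"

definition Conj :: "nat \<Rightarrow> real \<Rightarrow> nat \<Rightarrow> bool" where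
  "Conj N D q0 \<longleftrightarrow>
     (\<forall>q\<ge>q0. primepow q \<longrightarrow> (\<forall>F. Fq q F \<longrightarrow>
       (\<forall>w\<ge>1. \<forall>U\<ge>1. caps_uncovering F N w U \<noteq> {} \<longrightarrow>
         (\<exists>K\<in>caps_uncovering F N w U. \<exists>A\<in>uncovered F N K.
            real_of_int (newly_covered F N K A)
              \<ge> 1 / D * (((real w * (real q - 1) + 1) * real U) / pg_theta N q)))))"

end

theory Submission
  imports Defs "HOL-Real_Asymp.Real_Asymp"
begin

text \<open>
  Greedy construction. Given a \<open>w\<close>-cap, \<open>Conj\<close> provides a possibly different \<open>w\<close>-cap with the same
  number of uncovered points and a point whose addition multiplies that number by at most
  \<open>1 - w (q - 1) / (D \<theta>) \<le> exp (- w (q - 1) / (D \<theta>))\<close>. After \<open>k\<close> steps from a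
  single point at most
  \<open>\<theta> exp (- k\<^sup>2 (q - 1) / (2 D \<theta>))\<close> points are uncovered. With \<open>Y = sqrt (q ^ (N + 1)) / (q - 1)\<close>
  and \<open>k = \<lceil>sqrt D Y sqrt ((N + 1) ln q)\<rceil>\<close> this is less than \<open>Y\<close>, and the cap can be completed by
  adding at most one point for each point still uncovered.
\<close>

section \<open>Extending caps by uncovered points\<close>

lemma cap_insert_uncovered:
  assumes cap: "cap F N k K" and A: "A \<in> uncovered F N K"
  shows "cap F N (Suc k) (K \<union> {A})"
proof -
  have Apt: "A \<in> pg_points F N" and nc: "\<not> covered F N K A"
    using A by (auto simp: uncovered_def)
  have fin: "finite K" and Kpt: "K \<subseteq> pg_points F N" and cK: "card K = k"
    using cap by (auto simp: cap_def)
  have AK: "A \<notin> K"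
    using nc by (simp add: covered_def)
  \<comment> \<open>No line through \<open>A\<close> carries two points of \<open>K\<close>. A third
    point of \<open>K\<close> on it would violate the cap property; otherwise the line meets
    \<open>K\<close> in exactly two points and covers \<open>A\<close>.\<close>
  have no_line: False
    if l: "l \<in> pg_lines F N" "A \<in> l" "Q \<in> l" "R \<in> l" and QR: "Q \<in> K" "R \<in> K" "Q \<noteq> R" for l Q R
  proof -
    have "l \<inter> K = {Q, R}"
    proof (rule ccontr)
      assume "l \<inter> K \<noteq> {Q, R}"
      then obtain P where P: "P \<in> l" "P \<in> K" "P \<noteq> Q" "P \<noteq> R"
        using l QR by blast
      then have "pg_collinear F N {P, Q, R}"
        using l by (auto simp: pg_collinear_def)
      then show False
        using cap P QR unfolding cap_def by blast
    qed
    then have "card (l \<inter> K) = 2"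
      using QR by simp
    then show False
      using nc l by (auto simp: covered_def)
  qed
  have "\<not> pg_collinear F N {P, Q, R}"
    if "P \<in> K \<union> {A}" "Q \<in> K \<union> {A}" "R \<in> K \<union> {A}" "P \<noteq> Q" "P \<noteq> R" "Q \<noteq> R" for P Q R
  proof (cases "A \<in> {P, Q, R}")
    case True
    show ?thesis
    proof
      assume "pg_collinear F N {P, Q, R}"
      then obtain l where "l \<in> pg_lines F N" "P \<in> l" "Q \<in> l" "R \<in> l"
        by (auto simp: pg_collinear_def)
      with True that no_line show False
        by blast
    qed
  next
    case False
    then show ?thesis
      using cap that unfolding cap_def by blast
  qed
  then show ?thesis
    using fin Kpt cK AK Apt by (simp add: cap_def)
qed

text \<open>Lines meeting \<open>K\<close> in two points miss the uncovered point \<open>A\<close>,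
  so they still meet the enlarged set in two points and cover what they covered before. The
  inclusion is strict because \<open>A\<close> itself becomes covered.\<close>

lemma uncovered_insert_psubset:
  assumes A: "A \<in> uncovered F N K"
  shows "uncovered F N (K \<union> {A}) \<subset> uncovered F N K"
proof -
  have "covered F N (K \<union> {A}) P" if "covered F N K P" for P
  proof -
    have "l \<inter> (K \<union> {A}) = l \<inter> K" if "l \<in> pg_lines F N" "card (l \<inter> K) = 2" for l
      using A that by (auto simp: uncovered_def covered_def)
    then show ?thesis
      using that unfolding covered_def by (metis UnI1)
  qed
  moreover have "covered F N (K \<union> {A}) A"
    by (simp add: covered_def)
  ultimately show ?thesis
    using A by (auto simp: uncovered_def)
qed

text \<open>An additional point \<open>P\<close> of a larger cap would be covered, hence lie on a
  line with two points of \<open>K\<close>: a collinear triple inside the larger cap.\<close>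

lemma complete_cap_if_uncovered_empty:
  assumes cap: "cap F N k K" and U: "uncovered F N K = {}"
  shows "complete_cap F N k K"
proof -
  have False if K': "cap F N (k + 1) K'" and sub: "K \<subseteq> K'" for K'
  proof -
    have "K \<noteq> K'"
      using cap K' by (auto simp: cap_def)
    with sub obtain P where P: "P \<in> K'" "P \<notin> K"
      by blast
    moreover have "P \<in> pg_points F N"
      using K' P by (auto simp: cap_def)
    ultimately obtain l where l: "l \<in> pg_lines F N" "P \<in> l" "card (l \<inter> K) = 2"
      using U by (auto simp: uncovered_def covered_def)
    then obtain Q R where QR: "l \<inter> K = {Q, R}" "Q \<noteq> R"
      by (auto simp: card_2_iff)
    then have "pg_collinear F N {P, Q, R}"
      using l by (auto simp: pg_collinear_def)
    moreover have "Q \<in> K" "R \<in> K"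
      using QR by auto
    ultimately show False
      using K' P QR(2) sub unfolding cap_def by (metis subsetD)
  qed
  then show ?thesis
    using cap by (auto simp: complete_cap_def)
qed

text \<open>Adding an uncovered point raises the size by one and lowers the uncovered count by at
  least one, so the sum on the right never grows. When nothing is uncovered, the cap is
  complete.\<close>

lemma t2_le_cap_plus_uncovered:
  assumes "finite (pg_points F N)" "cap F N w K"
  shows "t2 F N \<le> w + card (uncovered F N K)"
  using assms(2)
proof (induction "card (uncovered F N K)" arbitrary: w K rule: less_induct)
  case less
  have fin: "finite (uncovered F N K)"
    using assms(1) by (simp add: uncovered_def)
  show ?case
  proof (cases "uncovered F N K = {}")
    case True
    then have "complete_cap F N w K"
      using less.prems complete_cap_if_uncovered_empty by blast
    then have "t2 F N \<le> w"
      unfolding t2_def by (blast intro: Least_le)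
    then show ?thesis by simp
  next
    case False
    then obtain A where A: "A \<in> uncovered F N K" by blast
    have lt: "card (uncovered F N (K \<union> {A})) < card (uncovered F N K)"
      using uncovered_insert_psubset[OF A] fin by (rule psubset_card_mono[rotated])
    have "t2 F N \<le> Suc w + card (uncovered F N (K \<union> {A}))"
      using less.hyps[OF lt] cap_insert_uncovered[OF less.prems A] by blast
    with lt show ?thesis by simp
  qed
qed

section \<open>Bounding the number of points of PG(N,q)\<close>

lemma finite_pg_points:
  assumes "finite (carrier F)"
  shows "finite (pg_points F N)"
proof -
  have "finite ({..N} \<rightarrow>\<^sub>E carrier F)"
    using assms by (intro finite_PiE) auto
  then show ?thesis
    unfolding pg_points_def nonzero_vecs_def by (intro finite_imageI) simp
qed

lemma nonzero_vecs_nonempty: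
  assumes "field F"
  shows "nonzero_vecs F N \<noteq> {}"
proof -
  interpret field F by fact
  have "(\<lambda>i\<in>{..N}. \<one>\<^bsub>F\<^esub>) \<in> nonzero_vecs F N"
    by (auto simp: nonzero_vecs_def)
  then show ?thesis by blast
qed

lemma span1_scale:
  assumes "field F" and u: "u \<in> nonzero_vecs F N"
    and a: "a \<in> carrier F" "a \<noteq> \<zero>\<^bsub>F\<^esub>"
  shows "span1 F N (\<lambda>i\<in>{..N}. a \<otimes>\<^bsub>F\<^esub> u i) = span1 F N u"
proof -
  interpret field F by fact
  have uc: "u i \<in> carrier F" if "i \<le> N" for i
    using u that by (auto simp: nonzero_vecs_def)
  have au: "a \<in> Units F"
    using a by (simp add: field_Units)
  show ?thesis
  proof (rule Set.set_eqI)
    fix x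
    have "x \<in> span1 F N u" if "x \<in> span1 F N (\<lambda>i\<in>{..N}. a \<otimes>\<^bsub>F\<^esub> u i)"
    proof -
      from that obtain b where b: "b \<in> carrier F"
        and x: "x = (\<lambda>i\<in>{..N}. b \<otimes>\<^bsub>F\<^esub> (\<lambda>i\<in>{..N}. a \<otimes>\<^bsub>F\<^esub> u i) i)"
        by (auto simp: span1_def)
      have "x = (\<lambda>i\<in>{..N}. (b \<otimes>\<^bsub>F\<^esub> a) \<otimes>\<^bsub>F\<^esub> u i)"
        unfolding x using a b uc by (intro restrict_ext) (simp add: m_assoc)
      then show ?thesis
        using a b unfolding span1_def by blast
    qed
    moreover have "x \<in> span1 F N (\<lambda>i\<in>{..N}. a \<otimes>\<^bsub>F\<^esub> u i)" if "x \<in> span1 F N u"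
    proof -
      from that obtain b where b: "b \<in> carrier F" and x: "x = (\<lambda>i\<in>{..N}. b \<otimes>\<^bsub>F\<^esub> u i)"
        by (auto simp: span1_def)
      have ic: "inv\<^bsub>F\<^esub> a \<in> carrier F"
        using au by (rule Units_inv_closed)
      \<comment> \<open>Since \<open>a\<close> is a unit, \<open>b / a\<close> serves as the
        coefficient with respect to the scaled vector.\<close>
      have "b \<otimes>\<^bsub>F\<^esub> u i = (b \<otimes>\<^bsub>F\<^esub> inv\<^bsub>F\<^esub> a) \<otimes>\<^bsub>F\<^esub> (a \<otimes>\<^bsub>F\<^esub> u i)" if "i \<le> N" for i
      proof -
        have "(b \<otimes>\<^bsub>F\<^esub> inv\<^bsub>F\<^esub> a) \<otimes>\<^bsub>F\<^esub> (a \<otimes>\<^bsub>F\<^esub> u i) = b \<otimes>\<^bsub>F\<^esub> ((inv\<^bsub>F\<^esub> a \<otimes>\<^bsub>F\<^esub> a) \<otimes>\<^bsub>F\<^esub> u i)"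
          using a b ic uc[OF that] by (simp add: m_assoc)
        then show ?thesis
          using au b uc[OF that] by simp
      qed
      then have "x = (\<lambda>i\<in>{..N}. (b \<otimes>\<^bsub>F\<^esub> inv\<^bsub>F\<^esub> a) \<otimes>\<^bsub>F\<^esub> (\<lambda>i\<in>{..N}. a \<otimes>\<^bsub>F\<^esub> u i) i)"
        unfolding x by (intro restrict_ext) simp
      then show ?thesis
        using b ic unfolding span1_def by blast
    qed
    ultimately show "x \<in> span1 F N (\<lambda>i\<in>{..N}. a \<otimes>\<^bsub>F\<^esub> u i) \<longleftrightarrow> x \<in> span1 F N u"
      by blast
  qed
qed

text \<open>The multiples of \<open>u\<close> by the nonzero scalars all represent the same point.
  They are pairwise distinct because the scalar can be cancelled at a coordinate where
  \<open>u\<close> does not vanish.\<close>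

lemma card_span1_fibre_ge:
  assumes "field F" "finite (carrier F)" and u: "u \<in> nonzero_vecs F N"
  shows "card (carrier F) - 1 \<le> card {v \<in> nonzero_vecs F N. span1 F N v = span1 F N u}"
    (is "_ \<le> card ?B")
proof -
  interpret field F by fact
  let ?f = "\<lambda>a. \<lambda>i\<in>{..N}. a \<otimes>\<^bsub>F\<^esub> u i"
  obtain j where j: "j \<le> N" "u j \<noteq> \<zero>\<^bsub>F\<^esub>"
    using u by (auto simp: nonzero_vecs_def)
  have uc: "u i \<in> carrier F" if "i \<le> N" for i
    using u that by (auto simp: nonzero_vecs_def)
  have "finite ?B"
  proof -
    have "finite ({..N} \<rightarrow>\<^sub>E carrier F)"
      using assms(2) by (intro finite_PiE) auto
    then show ?thesis
      by (rule rev_finite_subset) (auto simp: nonzero_vecs_def)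
  qed
  moreover have "inj_on ?f (carrier F - {\<zero>\<^bsub>F\<^esub>})"
  proof (rule inj_onI)
    fix a b
    assume ab: "a \<in> carrier F - {\<zero>\<^bsub>F\<^esub>}" "b \<in> carrier F - {\<zero>\<^bsub>F\<^esub>}" and eq: "?f a = ?f b"
    have "a \<otimes>\<^bsub>F\<^esub> u j = b \<otimes>\<^bsub>F\<^esub> u j"
      using fun_cong[OF eq, of j] j by simp
    then show "a = b"
      using ab j uc[OF j(1)] by (simp add: m_rcancel)
  qed
  moreover have "?f ` (carrier F - {\<zero>\<^bsub>F\<^esub>}) \<subseteq> ?B"
  proof
    fix v assume "v \<in> ?f ` (carrier F - {\<zero>\<^bsub>F\<^esub>})"
    then obtain a where a: "a \<in> carrier F" "a \<noteq> \<zero>\<^bsub>F\<^esub>" and v: "v = ?f a"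
      by blast
    have "v j \<noteq> \<zero>\<^bsub>F\<^esub>"
      using a j uc[OF j(1)] v integral by auto
    then have "v \<in> nonzero_vecs F N"
      using a uc j v by (auto simp: nonzero_vecs_def)
    then show "v \<in> ?B"
      using span1_scale[OF assms(1) u a] v by simp
  qed
  ultimately have "card (carrier F - {\<zero>\<^bsub>F\<^esub>}) \<le> card ?B"
    by (intro card_inj_on_le)
  then show ?thesis
    by simp
qed

text \<open>Double counting: the fibres of \<open>span1\<close> over the points partition the
  nonzero vectors, and each fibre has at least \<open>q - 1\<close> elements.\<close>

lemma card_pg_points_le:
  assumes "field F" "finite (carrier F)"
  shows "real (card (pg_points F N)) \<le> pg_theta N (card (carrier F))"
proof -
  interpret field F by fact
  define q where "q = card (carrier F)"
  have "card {\<zero>\<^bsub>F\<^esub>, \<one>\<^bsub>F\<^esub>} \<le> card (carrier F)"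
    using assms(2) by (intro card_mono) auto
  then have q: "2 \<le> q"
    by (simp add: q_def)
  have finE: "finite ({..N} \<rightarrow>\<^sub>E carrier F)"
    using assms(2) by (intro finite_PiE) auto
  then have fin: "finite (nonzero_vecs F N)"
    by (simp add: nonzero_vecs_def)
  have "card (pg_points F N) * (q - 1) = (\<Sum>P\<in>pg_points F N. q - 1)"
    by simp
  also have "\<dots> \<le> (\<Sum>P\<in>pg_points F N. card {v \<in> nonzero_vecs F N. span1 F N v = P})"
    using card_span1_fibre_ge[OF assms]
    by (intro sum_mono) (auto simp: pg_points_def q_def)
  also have "\<dots> = card (nonzero_vecs F N)"
    using fin sum.image_gen[of "nonzero_vecs F N" "\<lambda>_. 1::nat" "span1 F N"]
    by (simp add: pg_points_def)
  also have "\<dots> \<le> q ^ (N + 1) - 1"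
  proof -
    let ?z = "\<lambda>i\<in>{..N}. \<zero>\<^bsub>F\<^esub>"
    have "nonzero_vecs F N \<subseteq> ({..N} \<rightarrow>\<^sub>E carrier F) - {?z}"
      by (auto simp: nonzero_vecs_def)
    then have "card (nonzero_vecs F N) \<le> card (({..N} \<rightarrow>\<^sub>E carrier F) - {?z})"
      using finE by (intro card_mono) auto
    also have "\<dots> = q ^ (N + 1) - 1"
      using finE by (subst card_Diff_singleton) (auto simp: card_PiE q_def)
    finally show ?thesis .
  qed
  finally have "real (card (pg_points F N) * (q - 1)) \<le> real (q ^ (N + 1) - 1)"
    by (simp only: of_nat_le_iff)
  then have "real (card (pg_points F N)) * (real q - 1) \<le> real q ^ (N + 1) - 1"
    using q by (simp add: of_nat_diff)
  then show ?thesis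
    using q by (simp add: pg_theta_def q_def field_simps)
qed

section \<open>The greedy construction and the bound on \<open>t2\<close>\<close>

lemma greedy_cap:
  fixes D :: real
  assumes conj: "Conj N D q0" and D: "D > 0" and q: "q \<ge> q0" "primepow q" and F: "Fq q F"
  shows "\<exists>w K. cap F N w K \<and> w \<le> Suc k \<and> (w = Suc k \<or> card (uncovered F N K) = 0) \<and>
    real (card (uncovered F N K))
      \<le> pg_theta N q * exp (- ((real q - 1) / (D * pg_theta N q) * real k ^ 2 / 2))"
proof (induction k)
  case 0
  have field: "field F" and card: "card (carrier F) = q"
    using F by (auto simp: Fq_def)
  \<comment> \<open>An infinite carrier would have \<open>card\<close> equal to 0, which
    \<open>q > 1\<close> excludes.\<close>
  have fin: "finite (carrier F)"
    using card primepow_gt_Suc_0[OF q(2)] by (intro card_ge_0_finite) simp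
  obtain P where P: "P \<in> pg_points F N"
    using nonzero_vecs_nonempty[OF field, of N] by (auto simp: pg_points_def)
  have "card (uncovered F N {P}) \<le> card (pg_points F N)"
    using finite_pg_points[OF fin] by (intro card_mono) (auto simp: uncovered_def)
  then have "real (card (uncovered F N {P})) \<le> pg_theta N q"
    using card_pg_points_le[OF field fin, of N] unfolding card by linarith
  moreover have "cap F N 1 {P}"
    using P by (auto simp: cap_def)
  ultimately show ?case
    by (intro exI[of _ 1] exI[of _ "{P}"]) simp
next
  case (Suc k)
  define t where "t = pg_theta N q"
  \<comment> \<open>Adding a suitable point to a \<open>w\<close>-cap covers at least the fraction
    \<open>c * w\<close> of the uncovered points.\<close>
  define c where "c = (real q - 1) / (D * t)"
  have q1: "real q > 1"
    using primepow_gt_Suc_0[OF q(2)] by simp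
  then have t: "t > 0"
    unfolding t_def pg_theta_def by (simp add: one_less_power del: power_Suc)
  have c: "c > 0"
    using q1 t D by (simp add: c_def)
  obtain w K where K: "cap F N w K" "w \<le> Suc k" "w = Suc k \<or> card (uncovered F N K) = 0"
    and U: "real (card (uncovered F N K)) \<le> t * exp (- (c * real k ^ 2 / 2))"
    using Suc.IH unfolding t_def c_def by blast
  show ?case
  \<comment> \<open>\<open>Conj\<close> speaks only of positive \<open>U\<close>. Once everything is
    covered, the cap is kept unchanged for all later \<open>k\<close>, which is why the invariant
    allows \<open>w\<close> to be smaller than \<open>Suc k\<close>.\<close>
  proof (cases "card (uncovered F N K) = 0")
    case True
    then show ?thesis
      using K t unfolding t_def by (intro exI[of _ w] exI[of _ K]) simp
  next
    case False
    then have w: "w = Suc k"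
      using K(3) by simp
    define u where "u = card (uncovered F N K)"
    have "caps_uncovering F N w u \<noteq> {}"
      using K by (auto simp: caps_uncovering_def u_def)
    moreover have "w \<ge> 1" "u \<ge> 1"
      using w False by (auto simp: u_def)
    \<comment> \<open>\<open>K'\<close> need not be related to \<open>K\<close>. Replacing
      \<open>K\<close> is harmless because the invariant sees only the size and the uncovered count,
      which agree.\<close>
    ultimately obtain K' A where K': "K' \<in> caps_uncovering F N w u" and A: "A \<in> uncovered F N K'"
      and step: "real_of_int (newly_covered F N K' A)
        \<ge> 1 / D * (((real w * (real q - 1) + 1) * real u) / t)"
      using conj q F unfolding Conj_def t_def by meson
    have cap': "cap F N w K'" and u': "card (uncovered F N K') = u"
      using K' by (auto simp: caps_uncovering_def)
    define v where "v = card (uncovered F N (K' \<union> {A}))"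
    \<comment> \<open>Weakens \<open>w * (q - 1) + 1\<close> to \<open>w * (q - 1)\<close>.\<close>
    have "c * w * u \<le> 1 / D * (((real w * (real q - 1) + 1) * real u) / t)"
      using D t by (simp add: c_def field_simps)
    with step have "real v \<le> real u * (1 - c * w)"
      by (simp add: newly_covered_def u' v_def algebra_simps)
    also have "\<dots> \<le> real u * exp (- (c * w))"
      using exp_ge_add_one_self[of "- (c * w)"] by (intro mult_left_mono) auto
    also have "\<dots> \<le> t * exp (- (c * real k ^ 2 / 2)) * exp (- (c * w))"
      using U by (intro mult_right_mono) (auto simp: u_def)
    also have "\<dots> = t * exp (- (c * real k ^ 2 / 2) - c * w)"
      by (simp add: exp_add[symmetric])
    \<comment> \<open>With \<open>w = k + 1\<close>, the sum of \<open>k^2 / 2\<close> and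
      \<open>w\<close> exceeds \<open>(k + 1)^2 / 2\<close> by \<open>1 / 2\<close>.\<close>
    also have "\<dots> \<le> t * exp (- (c * real (Suc k) ^ 2 / 2))"
      using c t by (simp add: w power2_eq_square field_simps)
    finally show ?thesis
      using cap_insert_uncovered[OF cap' A] w unfolding v_def t_def c_def
      by (intro exI[of _ "Suc w"] exI[of _ "K' \<union> {A}"]) simp
  qed
qed

text \<open>The number of steps is chosen so that the exponential factor is at most
  \<open>1 / s\<close>. As \<open>t\<close> is below \<open>s^2 / (q - 1)\<close>, fewer than
  \<open>s / (q - 1) = Y\<close> points then remain uncovered, and they are paid for one by
  one.\<close>

lemma t2_less:
  fixes D :: real
  assumes conj: "Conj N D q0" and D: "D > 0" and q: "q \<ge> q0" "primepow q" and F: "Fq q F"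
  shows "real (t2 F N) < sqrt (real q ^ (N + 1)) / (real q - 1)
           * (sqrt D * sqrt (real (N + 1) * ln (real q)) + 1) + 2"
proof -
  define s where "s = sqrt (real q ^ (N + 1))"
  define Y where "Y = s / (real q - 1)"
  define L where "L = sqrt (real (N + 1) * ln (real q))"
  define t where "t = pg_theta N q"
  \<comment> \<open>Rounding up costs less than 1 and the initial point costs 1, which together give
    the summand 2 of the bound.\<close>
  define k where "k = nat \<lceil>sqrt D * Y * L\<rceil>"
  have q1: "real q > 1"
    using primepow_gt_Suc_0[OF q(2)] by simp
  have s: "s > 0" "s ^ 2 = real q ^ (N + 1)"
    using q1 by (auto simp: s_def)
  have Y: "Y > 0"
    using s q1 by (simp add: Y_def)
  have L: "L \<ge> 0" "L ^ 2 = real (N + 1) * ln (real q)"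
    using q1 by (auto simp: L_def)
  have "real q ^ (N + 1) > 1"
    using q1 by (intro one_less_power) auto
  then have t: "t > 0" and t_less: "t < s ^ 2 / (real q - 1)"
    using q1 unfolding t_def pg_theta_def s(2) by (auto simp: divide_strict_right_mono)
  have finp: "finite (pg_points F N)"
    using F q1 by (intro finite_pg_points card_ge_0_finite) (simp add: Fq_def)
  have "sqrt D * Y * L \<ge> 0"
    using D Y L by simp
  then have k: "sqrt D * Y * L \<le> real k" "real k < sqrt D * Y * L + 1"
    unfolding k_def by linarith+
  \<comment> \<open>\<open>L^2\<close> is the logarithm of \<open>q^(N+1)\<close>, that is, of
    \<open>s^2\<close>.\<close>
  have exp_half: "exp (- (L ^ 2 / 2)) = 1 / s"
  proof -
    have "(exp (L ^ 2 / 2)) ^ 2 = exp (L ^ 2)"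
      by (simp add: power2_eq_square exp_add[symmetric])
    also have "\<dots> = s ^ 2"
      using q1 unfolding L(2) s(2) by (simp only: exp_of_nat_mult) simp
    finally have "exp (L ^ 2 / 2) = s"
      using s(1) by (simp add: power2_eq_iff_nonneg)
    then show ?thesis
      by (simp add: exp_minus field_simps)
  qed
  have exponent: "L ^ 2 / 2 \<le> (real q - 1) / (D * t) * real k ^ 2 / 2"
  proof -
    have "D * Y ^ 2 * L ^ 2 = (sqrt D * Y * L) ^ 2"
      using D by (simp add: power_mult_distrib)
    also have "\<dots> \<le> real k ^ 2"
      using k(1) \<open>sqrt D * Y * L \<ge> 0\<close> by (intro power_mono)
    finally have kk: "D * Y ^ 2 * L ^ 2 \<le> real k ^ 2" .
    \<comment> \<open>This form of the upper bound on \<open>t\<close> lets the factor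
      \<open>Y^2\<close> combine with \<open>D * L^2\<close>, so that the choice of \<open>k\<close>
      applies.\<close>
    have "s ^ 2 / (real q - 1) = (real q - 1) * Y ^ 2"
      using q1 by (simp add: Y_def power2_eq_square)
    then have "t \<le> (real q - 1) * Y ^ 2"
      using t_less by linarith
    then have "t * (D * L ^ 2) \<le> (real q - 1) * Y ^ 2 * (D * L ^ 2)"
      using D by (intro mult_right_mono) auto
    also have "\<dots> = (real q - 1) * (D * Y ^ 2 * L ^ 2)"
      by simp
    also have "\<dots> \<le> (real q - 1) * real k ^ 2"
      using kk q1 by (intro mult_left_mono) auto
    finally have "L ^ 2 \<le> (real q - 1) * real k ^ 2 / (D * t)"
      using D t by (simp add: pos_le_divide_eq mult_ac)
    then show ?thesis by simp
  qed
  obtain w K where K: "cap F N w K" "w \<le> Suc k"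
    and U: "real (card (uncovered F N K))
      \<le> t * exp (- ((real q - 1) / (D * t) * real k ^ 2 / 2))"
    using greedy_cap[OF assms] unfolding t_def by blast
  have "t * exp (- ((real q - 1) / (D * t) * real k ^ 2 / 2)) \<le> t * exp (- (L ^ 2 / 2))"
    using exponent t by simp
  also have "\<dots> < s ^ 2 / (real q - 1) * exp (- (L ^ 2 / 2))"
    by (intro mult_strict_right_mono t_less) simp
  also have "\<dots> = Y"
    using s(1) unfolding exp_half by (simp add: Y_def power2_eq_square)
  finally have "real (card (uncovered F N K)) < Y"
    using U by linarith
  moreover have "real (t2 F N) \<le> real w + real (card (uncovered F N K))"
    using t2_le_cap_plus_uncovered[OF finp K(1)] by linarith
  moreover have "real w \<le> real k + 1"
    using K(2) by linarith
  ultimately have "real (t2 F N) < Y * (sqrt D * L + 1) + 2"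
    using k(2) by (simp add: algebra_simps)
  then show ?thesis
    by (simp only: Y_def s_def L_def)
qed

section \<open>Asymptotics of the bound\<close>

lemma t2_bound_asymp_equiv:
  fixes D :: real and N :: nat
  assumes N: "N \<ge> 1" and D: "D > 0"
  shows "(\<lambda>q::nat. sqrt (real q ^ (N + 1)) / (real q - 1)
           * (sqrt D * sqrt (real (N + 1) * ln (real q)) + 1) + 2)
         \<sim>[at_top]
         (\<lambda>q. sqrt D * real q powr ((real N - 1) / 2) * sqrt (real (N + 1) * ln (real q)))"
proof -
  define p where "p = (real N - 1) / 2"
  define L where "L = (\<lambda>q::nat. sqrt D * sqrt (real (N + 1) * ln (real q)))"
  have p: "p \<ge> 0"
    using N by (simp add: p_def)
  have L_top: "filterlim L at_top at_top"
  proof -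
    define a where "a = real (N + 1)"
    define d where "d = sqrt D"
    have "a > 0" "d > 0"
      using D by (auto simp: a_def d_def)
    then have "filterlim (\<lambda>q::nat. d * sqrt (a * ln (real q))) at_top at_top"
      by real_asymp
    then show ?thesis
      by (simp add: L_def a_def d_def)
  qed
  have q_equiv: "(\<lambda>q::nat. real q / (real q - 1)) \<sim>[at_top] (\<lambda>_. 1)"
    by real_asymp
  \<comment> \<open>Absorbs both additive constants: 1 against \<open>L\<close>, and 2 against the
    whole leading term.\<close>
  have const_smallo: "(\<lambda>_. c) \<in> o(f)" if "filterlim f at_top at_top" for c :: real and f :: "nat \<Rightarrow> real"
  proof -
    have "f \<in> \<omega>(\<lambda>_. 1)"
      using that by (simp add: smallomega_1_conv_filterlim filterlim_at_top_imp_at_infinity)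
    then have "(\<lambda>_. 1) \<in> o(f)"
      by (simp add: smallomega_iff_smallo)
    then show ?thesis
      by (rule landau_o.big_small_trans[rotated]) simp
  qed
  have "(\<lambda>q. L q + 1) \<sim>[at_top] L"
    using const_smallo[OF L_top] by (simp add: asymp_equiv_add_right)
  then have "(\<lambda>q::nat. real q / (real q - 1) * (real q powr p * (L q + 1)))
      \<sim>[at_top] (\<lambda>q. 1 * (real q powr p * L q))"
    using q_equiv by (intro asymp_equiv_intros)
  \<comment> \<open>For \<open>q\<close> at least 1 the power factor is at least 1, since
    \<open>p\<close> is nonnegative; so the product dominates \<open>L\<close>.\<close>
  moreover have "filterlim (\<lambda>q. real q powr p * L q) at_top at_top"
    using L_top
  proof (rule filterlim_at_top_mono)
    show "eventually (\<lambda>q::nat. L q \<le> real q powr p * L q) at_top"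
      using eventually_ge_at_top[of 1]
    proof eventually_elim
      case (elim q)
      then have "1 \<le> real q powr p" "0 \<le> L q"
        using p D by (auto simp: L_def ge_one_powr_ge_zero)
      then show ?case
        using mult_right_mono[of 1 "real q powr p" "L q"] by simp
    qed
  qed
  ultimately have main: "(\<lambda>q::nat. real q / (real q - 1) * (real q powr p * (L q + 1)) + 2)
      \<sim>[at_top] (\<lambda>q. real q powr p * L q)"
    using const_smallo by (subst asymp_equiv_add_right) auto
  \<comment> \<open>The exponent \<open>(N + 1) / 2\<close> is \<open>1 + p\<close>; the split-off
    factor \<open>q\<close> pairs with the denominator \<open>q - 1\<close> to give a ratio tending
    to 1.\<close>
  have "sqrt (real q ^ (N + 1)) = real q * real q powr p" if "q > 0" for q :: nat
  proof -
    have "sqrt (real q ^ (N + 1)) = real q powr (real (N + 1) / 2)"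
      using that by (simp add: powr_half_sqrt[symmetric] powr_realpow[symmetric] powr_powr
          del: power_Suc)
    also have "\<dots> = real q powr (1 + p)"
      by (simp add: p_def field_simps)
    finally show ?thesis
      using that by (simp add: powr_add)
  qed
  then have "eventually (\<lambda>q::nat. real q / (real q - 1) * (real q powr p * (L q + 1)) + 2 =
      sqrt (real q ^ (N + 1)) / (real q - 1) * (L q + 1) + 2) at_top"
    by (intro eventually_mono[OF eventually_gt_at_top[of 0]]) simp
  from asymp_equiv_transfer[OF main this always_eventually[OF allI[OF refl]]]
  show ?thesis
    by (simp add: L_def p_def mult_ac)
qed

theorem theorem1p1:
  fixes N q0 :: nat and D :: real
  assumes "N \<ge> 3" and "D \<ge> 1" and "q0 \<ge> 1"
  shows
    "(Conj N D q0 \<longrightarrow>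
        (\<forall>q\<ge>q0. primepow q \<longrightarrow> (\<forall>F. Fq q F \<longrightarrow>
           real (t2 F N) < sqrt (real q ^ (N + 1)) / (real q - 1)
                             * (sqrt D * sqrt (real (N + 1) * ln (real q)) + 1) + 2))) \<and>
     (\<lambda>q::nat. sqrt (real q ^ (N + 1)) / (real q - 1)
                 * (sqrt D * sqrt (real (N + 1) * ln (real q)) + 1) + 2)
       \<sim>[at_top] (\<lambda>q. sqrt D * real q powr ((real N - 1) / 2) * sqrt (real (N + 1) * ln (real q))) \<and>
     (Conj N 1 q0 \<longrightarrow>
        (\<forall>q\<ge>q0. primepow q \<longrightarrow> (\<forall>F. Fq q F \<longrightarrow>
           real (t2 F N) < sqrt (real q ^ (N + 1)) / (real q - 1)
                             * (sqrt (real (N + 1) * ln (real q)) + 1) + 2))) \<and>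
     (\<lambda>q::nat. sqrt (real q ^ (N + 1)) / (real q - 1)
                 * (sqrt (real (N + 1) * ln (real q)) + 1) + 2)
       \<sim>[at_top] (\<lambda>q. real q powr ((real N - 1) / 2) * sqrt (real (N + 1) * ln (real q)))"
  \<comment> \<open>Part (ii) is the case \<open>D = 1\<close>, where \<open>sqrt 1\<close>
    simplifies away.\<close>
  using t2_less[of N D q0] t2_less[of N 1 q0]
    t2_bound_asymp_equiv[of N D] t2_bound_asymp_equiv[of N 1] assms
  by (simp del: power_Suc)

end
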